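(* Let $1\le m<n$ be integers and let $T$ be a real $(n\times m)$-matrix of full rank $m$ with singular values $\sigma_1,\ldots,\sigma_m$. The expected value and the variance $$E=\frac{1}{n\nu_n}\int_{S^{n-1}}\|T^t\eta\|^2\,d\eta,\quad V=\frac{1}{n\nu_n}\int_{S^{n-1}}\big(\|T^t\eta\|^2-E\big)^2\,d\eta$$ depend only on the singular values $\sigma_1,\ldots,\sigma_m$ of $T$. In terms of the power sums $$A_1=\sum_{i=1}^m\sigma_i^2,\quad A_2=\sum_{i=1}^m\sigma_i^4,$$ they read $$E=\frac{A_1}{n},\quad V=\frac{2n\,A_2-2A_1^2}{n^2(n+2)}.$$
   Context: $\|\cdot\|$ is the Euclidean norm, $T^t$ is the transpose of $T$, $S^{n-1}$ is the unit sphere of $\mathbb{R}^n$ with surface measure $d\eta$, and $\nu_n$ is the volume of the unit ball of $\mathbb{R}^n$ (so $n\nu_n$ is the area of $S^{n-1}$). *)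

theory Defs
  imports "HOL-Analysis.Analysis" "HOL-Computational_Algebra.Polynomial"
begin

(* The surface measure sigma of the unit sphere S, in the polar-coordinate form
   sigma(A) = n * vol {r *R x | 0 < r < 1, x : A} with n the dimension: the push-forward,
   along x |-> x / |x| (which is sgn in a normed space), of n times Lebesgue measure on the
   punctured open unit ball.  See emeasure_sphere_measure for the displayed formula. *)
definition sphere_measure :: "'a::euclidean_space measure" where
  "sphere_measure =
     scale_measure (of_nat DIM('a))
       (distr (restrict_space lborel (ball 0 1 - {0})) (restrict_space borel (sphere 0 1)) sgn)"

lemma measurable_sgn_sphere:
  "sgn \<in> restrict_space lborel (ball 0 1 - {0::'a::euclidean_space})
           \<rightarrow>\<^sub>M restrict_space borel (sphere 0 1)"
proof (rule measurable_restrict_space2)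
  show "sgn \<in> space (restrict_space lborel (ball 0 1 - {0::'a})) \<rightarrow> sphere 0 1"
    by (auto simp: space_restrict_space norm_sgn)
  have "(\<lambda>x::'a. x /\<^sub>R norm x) \<in> borel_measurable borel"
    by measurable
  then have "(sgn :: 'a \<Rightarrow> 'a) \<in> borel_measurable lborel"
    by (simp add: sgn_div_norm[abs_def])
  then show "sgn \<in> restrict_space lborel (ball 0 1 - {0::'a}) \<rightarrow>\<^sub>M borel"
    by (rule measurable_restrict_space1)
qed

lemma emeasure_sphere_measure:
  fixes A :: "'a::euclidean_space set"
  assumes A: "A \<in> sets borel" "A \<subseteq> sphere 0 1"
  shows "emeasure sphere_measure A =
           of_nat DIM('a) * emeasure lborel {r *\<^sub>R x |r x. 0 < r \<and> r < 1 \<and> x \<in> A}"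
proof -
  have eq: "sgn -` A \<inter> (ball 0 1 - {0}) = {r *\<^sub>R x |r x. 0 < r \<and> r < 1 \<and> x \<in> A}"
  proof (intro set_eqI iffI)
    fix y assume y: "y \<in> sgn -` A \<inter> (ball 0 1 - {0::'a})"
    then have "y = norm y *\<^sub>R sgn y" "0 < norm y" "norm y < 1" "sgn y \<in> A"
      by (auto simp: sgn_div_norm)
    then show "y \<in> {r *\<^sub>R x |r x. 0 < r \<and> r < 1 \<and> x \<in> A}" by blast
  next
    fix y assume "y \<in> {r *\<^sub>R x |r x. 0 < r \<and> r < 1 \<and> x \<in> A}"
    then obtain r x where y: "y = r *\<^sub>R x" "0 < r" "r < 1" "x \<in> A" by blast
    then have "norm x = 1" using A by auto
    then show "y \<in> sgn -` A \<inter> (ball 0 1 - {0})"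
      using y by (auto simp: sgn_div_norm)
  qed
  have "A \<in> sets (restrict_space borel (sphere 0 1))"
    using A by (subst sets_restrict_space_iff) auto
  then have "emeasure sphere_measure A =
      of_nat DIM('a) * emeasure (restrict_space lborel (ball 0 1 - {0})) (sgn -` A \<inter> (ball 0 1 - {0}))"
    by (simp add: sphere_measure_def emeasure_distr measurable_sgn_sphere space_restrict_space)
  also have "\<dots> = of_nat DIM('a) * emeasure lborel (sgn -` A \<inter> (ball 0 1 - {0}))"
    by (subst emeasure_restrict_space) auto
  finally show ?thesis by (simp only: eq)
qed

definition sphere_mean :: "('a::euclidean_space \<Rightarrow> real) \<Rightarrow> real" where
  "sphere_mean f =
     1 / (real DIM('a) * measure lborel (ball (0::'a) 1)) * (\<integral>\<eta>. f \<eta> \<partial>sphere_measure)"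

(* Pitfall: real^'m^'n has n rows and m columns, so transpose T *v eta is in R^m. *)
definition E_sphere :: "real^'m^'n \<Rightarrow> real" where
  "E_sphere T = sphere_mean (\<lambda>\<eta>. (norm (transpose T *v \<eta>))\<^sup>2)"

definition V_sphere :: "real^'m^'n \<Rightarrow> real" where
  "V_sphere T = sphere_mean (\<lambda>\<eta>. ((norm (transpose T *v \<eta>))\<^sup>2 - E_sphere T)\<^sup>2)"

definition charpoly :: "'a::comm_ring_1^'n^'n \<Rightarrow> 'a poly" where
  "charpoly A = det (mat [:0, 1:] - map_matrix (\<lambda>a. [:a:]) A)"

(* transpose T ** T is an m x m positive semidefinite matrix, so all m roots of its characteristic
   polynomial are real and nonnegative, and the multiset has size m. *)
definition singular_values :: "real^'m^'n \<Rightarrow> real multiset" where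
  "singular_values T = image_mset sqrt (proots (charpoly (transpose T ** T)))"

end

theory Submission
  imports Defs
begin

text \<open>
  Lebesgue measure, and hence the surface measure of the sphere, is invariant under orthogonal maps,
  so the mean of $(v \cdot \eta)^k$ depends only on $|v|$ and is proportional to $|v|^k$. For
  $k = 4$, polarization gives the mean of $(v \cdot \eta)^2 (w \cdot \eta)^2$ up to a constant, which
  summation over an orthonormal basis determines. Since $|T^t \eta|^2$ is the sum of the
  $(t_k \cdot \eta)^2$ over the columns $t_k$ of $T$, the mean and the variance are expressed by the
  traces of $S = T^t T$ and $S^2$. These are the power sums of the roots of the characteristic
  polynomial of $S$; that it splits over the reals is part of the hypothesis, which provides
  $m$ singular values.
\<close>

section \<open>Invariance of Lebesgue measure under orthogonal maps\<close>

lemma nn_integral_lborel_translation: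
  fixes c :: "'a::euclidean_space"
  assumes [measurable]: "g \<in> borel_measurable borel"
  shows "(\<integral>\<^sup>+x. g (c + x) \<partial>lborel) = (\<integral>\<^sup>+x. g x \<partial>lborel)"
proof -
  have "(\<integral>\<^sup>+x. g x \<partial>lborel) = (\<integral>\<^sup>+x. g x \<partial>distr lborel borel ((+) c))"
    by (simp add: lborel_distr_plus)
  also have "\<dots> = (\<integral>\<^sup>+x. g (c + x) \<partial>lborel)"
    by (subst nn_integral_distr) auto
  finally show ?thesis by simp
qed

lemma orthogonal_transformation_borel_measurable:
  fixes f :: "'a::euclidean_space \<Rightarrow> 'a"
  assumes "orthogonal_transformation f"
  shows "f \<in> borel_measurable borel"
  using orthogonal_transformation_linear[OF assms]
  by (intro borel_measurable_continuous_onI linear_continuous_on linear_conv_bounded_linear[THEN iffD1])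

text \<open>
  The uniqueness argument for Haar measure: integrating $1_A(f x) \, 1_B(y - f x)$ over $x$ and $y$ in
  both orders, with $B$ the unit ball, compares the two translation-invariant measures on $A$, and
  they agree on $B$ because $f$ preserves it.
\<close>

lemma lborel_distr_orthogonal_transformation:
  fixes f :: "'a::euclidean_space \<Rightarrow> 'a"
  assumes f: "orthogonal_transformation f"
  shows "distr lborel borel f = lborel"
proof (rule measure_eqI)
  show "sets (distr lborel borel f) = sets lborel" by simp
next
  fix A :: "'a set" assume "A \<in> sets (distr lborel borel f)"
  then have [measurable]: "A \<in> sets borel" by simp
  have lin: "linear f" using f by (rule orthogonal_transformation_linear)
  note [measurable] = orthogonal_transformation_borel_measurable[OF f]
  obtain g where g: "\<And>y. f (g y) = y"
    using orthogonal_transformation_surj[OF f] by (metis surjD)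
  have norm_f: "norm (f x) = norm x" for x
    using f by (simp add: orthogonal_transformation)
  let ?B = "ball (0::'a) 1"
  have [measurable]: "?B \<in> sets borel" by simp
  have "emeasure (distr lborel borel f) A * emeasure lborel ?B
      = (\<integral>\<^sup>+x. indicator A (f x) * emeasure lborel ?B \<partial>lborel)"
    by (subst nn_integral_multc) (auto simp: nn_integral_distr simp flip: nn_integral_indicator)
  also have "\<dots> = (\<integral>\<^sup>+x. indicator A (f x) * (\<integral>\<^sup>+y. indicator ?B (- f x + y) \<partial>lborel) \<partial>lborel)"
    by (subst nn_integral_lborel_translation) auto
  also have "\<dots> = (\<integral>\<^sup>+x. (\<integral>\<^sup>+y. indicator A (f x) * indicator ?B (- f x + y) \<partial>lborel) \<partial>lborel)"
    by (simp add: nn_integral_cmult)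
  also have "\<dots> = (\<integral>\<^sup>+y. (\<integral>\<^sup>+x. indicator A (f x) * indicator ?B (- f x + y) \<partial>lborel) \<partial>lborel)"
    by (rule lborel_pair.Fubini'[symmetric]) measurable
  \<comment> \<open>Translating \<open>x\<close> by \<open>g y\<close>, where
    \<open>f (g y) = y\<close>, turns the argument of \<open>A\<close> into \<open>f x + y\<close>
    and that of the ball into \<open>- f x\<close>, which lies in the ball iff \<open>x\<close>
    does.\<close>
  also have "\<dots> = (\<integral>\<^sup>+y. (\<integral>\<^sup>+x. indicator A (f (g y + x)) * indicator ?B (- f (g y + x) + y) \<partial>lborel) \<partial>lborel)"
    by (intro nn_integral_cong nn_integral_lborel_translation[symmetric]) measurable
  also have "\<dots> = (\<integral>\<^sup>+y. (\<integral>\<^sup>+x. indicator A (f x + y) * indicator ?B x \<partial>lborel) \<partial>lborel)"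
    by (simp add: linear_add[OF lin] g norm_f indicator_def add.commute)
  also have "\<dots> = (\<integral>\<^sup>+x. (\<integral>\<^sup>+y. indicator A (f x + y) * indicator ?B x \<partial>lborel) \<partial>lborel)"
    by (rule lborel_pair.Fubini') measurable
  also have "\<dots> = (\<integral>\<^sup>+x. emeasure lborel A * indicator ?B x \<partial>lborel)"
    by (simp add: nn_integral_multc nn_integral_lborel_translation[where g = "indicator A"])
  also have "\<dots> = emeasure lborel A * emeasure lborel ?B"
    by (simp add: nn_integral_cmult)
  finally have eq: "emeasure (distr lborel borel f) A * emeasure lborel ?B
      = emeasure lborel A * emeasure lborel ?B" .
  have "emeasure lborel ?B \<noteq> 0" "emeasure lborel ?B < \<infinity>"
    using content_ball_pos[of 1 "0::'a"] emeasure_lborel_ball_finite[of "0::'a" 1]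
    by (auto simp: measure_def)
  with eq show "emeasure (distr lborel borel f) A = emeasure lborel A"
    by (auto simp: ennreal_mult_cancel_left mult.commute[of _ "emeasure lborel ?B"])
qed

section \<open>The surface measure: total mass and orthogonal invariance\<close>

lemma sets_sphere_measure [measurable_cong]:
  "sets (sphere_measure :: 'a::euclidean_space measure) = sets (restrict_space borel (sphere 0 1))"
  by (simp add: sphere_measure_def)

lemma space_sphere_measure: "space sphere_measure = (sphere 0 1 :: 'a::euclidean_space set)"
  by (simp add: sphere_measure_def space_scale_measure space_restrict_space)

text \<open>The cone over the whole sphere is the punctured ball, and the origin is a null set. The
  value is the normalizing constant in \<open>sphere_mean\<close>.\<close>

lemma emeasure_sphere_measure_sphere:
  "emeasure sphere_measure (sphere 0 1 :: 'a::euclidean_space set)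
     = of_nat DIM('a) * emeasure lborel (ball (0::'a) 1)"
proof -
  have "{r *\<^sub>R x |r x::'a. 0 < r \<and> r < 1 \<and> x \<in> sphere 0 1} = ball 0 1 - {0}"
  proof (intro set_eqI iffI)
    fix y :: 'a assume "y \<in> ball 0 1 - {0}"
    then have "y = norm y *\<^sub>R sgn y" "0 < norm y" "norm y < 1" "sgn y \<in> sphere 0 1"
      by (auto simp: sgn_div_norm)
    then show "y \<in> {r *\<^sub>R x |r x. 0 < r \<and> r < 1 \<and> x \<in> sphere 0 1}" by blast
  qed auto
  moreover have "emeasure lborel (ball 0 1 - {0::'a}) = emeasure lborel (ball (0::'a) 1)"
    by (rule emeasure_Diff_null_set) (auto simp: null_sets_def)
  ultimately show ?thesis
    by (subst emeasure_sphere_measure) auto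
qed

lemma finite_measure_sphere_measure:
  "finite_measure (sphere_measure :: 'a::euclidean_space measure)"
  by (rule finite_measureI)
     (use emeasure_lborel_ball_finite[of "0::'a" 1] in
       \<open>auto simp: space_sphere_measure emeasure_sphere_measure_sphere ennreal_mult_eq_top_iff\<close>)

lemma orthogonal_transformation_measurable_sphere:
  fixes f :: "'a::euclidean_space \<Rightarrow> 'a"
  assumes f: "orthogonal_transformation f"
  shows "f \<in> sphere_measure \<rightarrow>\<^sub>M sphere_measure"
  unfolding measurable_cong_sets[OF sets_sphere_measure sets_sphere_measure]
  using f orthogonal_transformation_borel_measurable[OF f]
  by (intro measurable_restrict_space2 measurable_restrict_space1)
     (auto simp: space_restrict_space orthogonal_transformation)

text \<open>A linear isometry commutes with forming cones, so the cone over a preimage is the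
  preimage of the cone, and the invariance of Lebesgue measure carries over.\<close>

lemma sphere_measure_distr_orthogonal_transformation:
  fixes f :: "'a::euclidean_space \<Rightarrow> 'a"
  assumes f: "orthogonal_transformation f"
  shows "distr sphere_measure sphere_measure f = sphere_measure"
proof (rule measure_eqI)
  fix A assume "A \<in> sets (distr sphere_measure sphere_measure f)"
  then have A: "A \<in> sets borel" "A \<subseteq> sphere 0 1"
    by (auto simp: sets_sphere_measure sets_restrict_space)
  have lin: "linear f" using f by (rule orthogonal_transformation_linear)
  note fm[measurable] = orthogonal_transformation_borel_measurable[OF f]
  have norm_f: "norm (f x) = norm x" for x
    using f by (simp add: orthogonal_transformation)
  note fms = orthogonal_transformation_measurable_sphere[OF f]
  define C where "C = (\<lambda>A :: 'a set. {r *\<^sub>R x |r x. 0 < r \<and> r < 1 \<and> x \<in> A})"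
  \<comment> \<open>Writing the truncated cone through a preimage under \<open>sgn\<close> makes it
    visibly Borel.\<close>
  have C: "C A = sgn -` A \<inter> (ball 0 1 - {0})"
  proof (intro set_eqI iffI)
    fix y assume y: "y \<in> sgn -` A \<inter> (ball 0 1 - {0::'a})"
    then have "y = norm y *\<^sub>R sgn y" "0 < norm y" "norm y < 1" "sgn y \<in> A"
      by (auto simp: sgn_div_norm)
    then show "y \<in> C A" unfolding C_def by blast
  next
    fix y assume "y \<in> C A"
    then obtain r x where y: "y = r *\<^sub>R x" "0 < r" "r < 1" "x \<in> A" unfolding C_def by blast
    then have "norm x = 1" using A by auto
    then show "y \<in> sgn -` A \<inter> (ball 0 1 - {0})"
      using y by (auto simp: sgn_div_norm)
  qed
  have "(\<lambda>x::'a. x /\<^sub>R norm x) \<in> borel_measurable borel"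
    by measurable
  then have [measurable]: "(sgn :: 'a \<Rightarrow> 'a) \<in> borel_measurable borel"
    by (simp add: sgn_div_norm[abs_def])
  have CA [measurable]: "C A \<in> sets borel"
    unfolding C using measurable_sets_borel[OF \<open>sgn \<in> borel_measurable borel\<close> A(1)]
    by (intro sets.Int) auto
  have "C (f -` A \<inter> sphere 0 1) = f -` C A"
  proof (intro set_eqI iffI)
    fix y assume "y \<in> C (f -` A \<inter> sphere 0 1)"
    then show "y \<in> f -` C A"
      by (fastforce simp: C_def linear_cmul[OF lin])
  next
    fix y assume "y \<in> f -` C A"
    then have "f (sgn y) \<in> A" "norm y < 1" "y \<noteq> 0"
      by (auto simp: C norm_f sgn_div_norm linear_cmul[OF lin] linear_0[OF lin])
    then have "y = norm y *\<^sub>R sgn y" "0 < norm y" "norm y < 1" "sgn y \<in> f -` A \<inter> sphere 0 1"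
      by (auto simp: sgn_div_norm)
    then show "y \<in> C (f -` A \<inter> sphere 0 1)" unfolding C_def by blast
  qed
  moreover have "f -` A \<inter> sphere 0 1 \<in> sets borel"
    using A(1) by (intro sets.Int) (auto intro: measurable_sets_borel[OF fm])
  ultimately have "emeasure sphere_measure (f -` A \<inter> sphere 0 1)
      = of_nat DIM('a) * emeasure lborel (f -` C A)"
    by (subst emeasure_sphere_measure) (auto simp: C_def)
  also have "emeasure lborel (f -` C A) = emeasure (distr lborel borel f) (C A)"
    by (simp add: emeasure_distr)
  also have "\<dots> = emeasure lborel (C A)"
    by (simp add: lborel_distr_orthogonal_transformation[OF f])
  also have "of_nat DIM('a) * \<dots> = emeasure sphere_measure A"
    using A by (simp add: emeasure_sphere_measure C_def)
  finally show "emeasure (distr sphere_measure sphere_measure f) A = emeasure sphere_measure A"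
    using A fms by (simp add: emeasure_distr space_sphere_measure sets_sphere_measure sets_restrict_space_iff)
qed simp

section \<open>Means over the sphere\<close>

text \<open>A continuous function is bounded on the compact sphere, whose measure is finite. This
  covers all the polynomial integrands below.\<close>

lemma integrable_sphere_measure:
  fixes f :: "'a::euclidean_space \<Rightarrow> real"
  assumes "continuous_on UNIV f"
  shows "integrable sphere_measure f"
proof -
  interpret finite_measure "sphere_measure :: 'a measure" by (rule finite_measure_sphere_measure)
  have "compact (f ` sphere 0 1)"
    using assms by (intro compact_continuous_image) (auto intro: continuous_on_subset)
  then obtain b where "\<And>x. x \<in> sphere 0 1 \<Longrightarrow> norm (f x) \<le> b"
    by (meson compact_imp_bounded bounded_iff imageI)
  moreover have "f \<in> borel_measurable sphere_measure"
    unfolding measurable_cong_sets[OF sets_sphere_measure refl]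
    by (intro measurable_restrict_space1 borel_measurable_continuous_onI assms)
  ultimately show ?thesis
    by (intro integrable_const_bound[where B = b] AE_I2) (auto simp: space_sphere_measure)
qed

lemma sphere_mean_const: "sphere_mean (\<lambda>_ :: 'a::euclidean_space. c) = c"
  using content_ball_pos[of 1 "0::'a"]
  by (simp add: sphere_mean_def space_sphere_measure measure_def emeasure_sphere_measure_sphere enn2real_mult)

lemma sphere_mean_cong:
  "(\<And>x. norm x = 1 \<Longrightarrow> f x = g x) \<Longrightarrow> sphere_mean f = sphere_mean g"
  unfolding sphere_mean_def
  by (rule arg_cong[of _ _ "\<lambda>x. _ * x"], rule Bochner_Integration.integral_cong)
     (auto simp: space_sphere_measure)

lemma sphere_mean_cmult: "sphere_mean (\<lambda>x. c * f x) = c * sphere_mean f"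
  by (simp add: sphere_mean_def)

lemma sphere_mean_add:
  assumes "continuous_on UNIV f" "continuous_on UNIV g"
  shows "sphere_mean (\<lambda>x. f x + g x) = sphere_mean f + sphere_mean g"
  using assms by (simp add: sphere_mean_def integrable_sphere_measure ring_distribs)

lemma sphere_mean_sum:
  assumes "\<And>i. i \<in> I \<Longrightarrow> continuous_on UNIV (f i)"
  shows "sphere_mean (\<lambda>x. \<Sum>i\<in>I. f i x) = (\<Sum>i\<in>I. sphere_mean (f i))"
  using assms by (simp add: sphere_mean_def integrable_sphere_measure sum_distrib_left)

lemma sphere_mean_orthogonal_transformation:
  fixes f :: "'a::euclidean_space \<Rightarrow> 'a"
  assumes f: "orthogonal_transformation f" and h: "continuous_on UNIV h"
  shows "sphere_mean (\<lambda>x. h (f x)) = sphere_mean h"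
proof -
  note fms = orthogonal_transformation_measurable_sphere[OF f]
  have "h \<in> borel_measurable sphere_measure"
    unfolding measurable_cong_sets[OF sets_sphere_measure refl]
    by (intro measurable_restrict_space1 borel_measurable_continuous_onI h)
  then show ?thesis
    unfolding sphere_mean_def
    using integral_distr[OF fms, of h] sphere_measure_distr_orthogonal_transformation[OF f]
    by simp
qed

section \<open>Second and fourth moments of linear forms\<close>

text \<open>For a unit vector \<open>e\<close>, some orthogonal map takes
  \<open>norm v *\<^sub>R e\<close> to \<open>v\<close>, so invariance reduces the mean for
  \<open>v\<close> to the one for \<open>e\<close>. The constant \<open>d\<close> stays abstract;
  summation over a basis determines it later.\<close>

lemma sphere_mean_power_inner_proportional:
  "\<exists>d. \<forall>v :: real^'n. sphere_mean (\<lambda>\<eta>. (v \<bullet> \<eta>)^k) = d * norm v ^ k"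
proof -
  obtain e :: "real^'n" where e: "norm e = 1"
    using norm_axis_1 by blast
  have "sphere_mean (\<lambda>\<eta>. (v \<bullet> \<eta>)^k) = sphere_mean (\<lambda>\<eta>. (e \<bullet> \<eta>)^k) * norm v ^ k" for v :: "real^'n"
  proof -
    obtain f where f: "orthogonal_transformation f" "f (norm v *\<^sub>R e) = v"
      using orthogonal_transformation_exists[of "norm v *\<^sub>R e" v] e by auto
    have "(v \<bullet> f \<eta>)^k = norm v ^ k * (e \<bullet> \<eta>)^k" for \<eta>
    proof -
      have "v \<bullet> f \<eta> = f (norm v *\<^sub>R e) \<bullet> f \<eta>" using f by simp
      also have "\<dots> = norm v * (e \<bullet> \<eta>)"
        using f(1) by (simp add: orthogonal_transformation_def)
      finally show ?thesis by (simp add: power_mult_distrib)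
    qed
    then show ?thesis
      using sphere_mean_orthogonal_transformation[OF f(1), of "\<lambda>\<eta>. (v \<bullet> \<eta>)^k"]
      by (simp add: sphere_mean_cmult continuous_intros mult.commute)
  qed
  then show ?thesis by blast
qed

lemma sum_axis_inner_square:
  "(\<Sum>i\<in>UNIV. (axis i 1 \<bullet> x)\<^sup>2) = (norm (x :: real^'n))\<^sup>2"
  unfolding power2_norm_eq_inner inner_vec_def[of x x] by (simp add: inner_axis' power2_eq_square)

text \<open>On the sphere the squared coordinates sum to 1, and each of them has the same mean
  \<open>d\<close>.\<close>

lemma sphere_mean_inner_square:
  fixes v :: "real^'n"
  shows "sphere_mean (\<lambda>\<eta>. (v \<bullet> \<eta>)\<^sup>2) = (norm v)\<^sup>2 / CARD('n)"
proof -
  obtain d where d: "\<And>v :: real^'n. sphere_mean (\<lambda>\<eta>. (v \<bullet> \<eta>)\<^sup>2) = d * (norm v)\<^sup>2"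
    using sphere_mean_power_inner_proportional[where k = 2] by blast
  have "1 = sphere_mean (\<lambda>\<eta>::real^'n. \<Sum>i\<in>UNIV. (axis i 1 \<bullet> \<eta>)\<^sup>2)"
    by (subst sphere_mean_const[symmetric, where 'a = "real^'n"], rule sphere_mean_cong)
       (simp add: sum_axis_inner_square)
  also have "\<dots> = CARD('n) * d"
    by (subst sphere_mean_sum) (auto simp: d continuous_intros)
  finally show ?thesis by (simp add: d field_simps)
qed

lemma sphere_mean_inner_square_mult:
  fixes v w :: "real^'n"
  shows "sphere_mean (\<lambda>\<eta>. (v \<bullet> \<eta>)\<^sup>2 * (w \<bullet> \<eta>)\<^sup>2)
     = ((norm v)\<^sup>2 * (norm w)\<^sup>2 + 2 * (v \<bullet> w)\<^sup>2) / (real CARD('n) * (real CARD('n) + 2))"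
proof -
  obtain c where c: "\<And>v :: real^'n. sphere_mean (\<lambda>\<eta>. (v \<bullet> \<eta>)^4) = c * norm v ^ 4"
    using sphere_mean_power_inner_proportional[where k = 4] by blast
  have I: "3 * sphere_mean (\<lambda>\<eta>. (v \<bullet> \<eta>)\<^sup>2 * (w \<bullet> \<eta>)\<^sup>2)
      = c * ((norm v)\<^sup>2 * (norm w)\<^sup>2 + 2 * (v \<bullet> w)\<^sup>2)" for v w :: "real^'n"
  proof -
    let ?M = "\<lambda>v :: real^'n. sphere_mean (\<lambda>\<eta>. (v \<bullet> \<eta>)^4)"
    let ?I = "sphere_mean (\<lambda>\<eta>. (v \<bullet> \<eta>)\<^sup>2 * (w \<bullet> \<eta>)\<^sup>2)"
    have norm4: "norm x ^ 4 = (x \<bullet> x)\<^sup>2" for x :: "real^'n"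
      by (simp add: power2_norm_eq_inner[symmetric])
    \<comment> \<open>Polarization: (a + b)^4 + (a - b)^4 = 2 a^4 + 2 b^4 + 12 a^2 b^2.\<close>
    have "?M (v + w) + ?M (v - w)
        = sphere_mean (\<lambda>\<eta>. 2 * (v \<bullet> \<eta>)^4 + (2 * (w \<bullet> \<eta>)^4 + 12 * ((v \<bullet> \<eta>)\<^sup>2 * (w \<bullet> \<eta>)\<^sup>2)))"
      by (subst sphere_mean_add[symmetric])
         (auto intro!: continuous_intros sphere_mean_cong
            simp: inner_add_left inner_diff_left power2_eq_square power4_eq_xxxx algebra_simps)
    also have "\<dots> = 2 * ?M v + (2 * ?M w + 12 * ?I)"
      by (simp add: sphere_mean_add sphere_mean_cmult continuous_intros)
    finally have "12 * ?I = c * (((v + w) \<bullet> (v + w))\<^sup>2 + ((v - w) \<bullet> (v - w))\<^sup>2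
        - 2 * (v \<bullet> v)\<^sup>2 - 2 * (w \<bullet> w)\<^sup>2)"
      unfolding c norm4 right_diff_distrib distrib_left by linarith
    also have "\<dots> = 4 * (c * ((v \<bullet> v) * (w \<bullet> w) + 2 * (v \<bullet> w)\<^sup>2))"
      by (simp add: inner_add_left inner_add_right inner_diff_left inner_diff_right
            inner_commute[of w v] power2_eq_square algebra_simps)
    finally show ?thesis by (simp add: power2_norm_eq_inner)
  qed
  \<comment> \<open>The double sum is the square of the sum of squared coordinates, hence 1 on the
    sphere; the factor 3 matches the left side of \<open>I\<close>.\<close>
  have "3 = 3 * sphere_mean (\<lambda>\<eta>::real^'n. \<Sum>i\<in>UNIV. \<Sum>j\<in>UNIV. (axis i 1 \<bullet> \<eta>)\<^sup>2 * (axis j 1 \<bullet> \<eta>)\<^sup>2)"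
  proof -
    have "1 = sphere_mean (\<lambda>\<eta>::real^'n. \<Sum>i\<in>UNIV. \<Sum>j\<in>UNIV. (axis i 1 \<bullet> \<eta>)\<^sup>2 * (axis j 1 \<bullet> \<eta>)\<^sup>2)"
      by (subst sphere_mean_const[symmetric, where 'a = "real^'n"], rule sphere_mean_cong)
         (simp add: sum_axis_inner_square flip: sum_product)
    then show ?thesis by simp
  qed
  also have "\<dots> = (\<Sum>i\<in>UNIV. \<Sum>j\<in>UNIV. 3 * sphere_mean (\<lambda>\<eta>::real^'n. (axis i 1 \<bullet> \<eta>)\<^sup>2 * (axis j 1 \<bullet> \<eta>)\<^sup>2))"
    by (subst sphere_mean_sum, (intro continuous_intros)?, subst sphere_mean_sum)
       (auto simp: continuous_intros sum_distrib_left)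
  \<comment> \<open>By orthonormality a diagonal pair contributes 3c and any other pair c, in total
    3cn + cn(n - 1) = cn(n + 2).\<close>
  also have "\<dots> = (\<Sum>i\<in>(UNIV::'n set). \<Sum>j\<in>(UNIV::'n set). c * (1 + (if i = j then 2 else 0)))"
    by (auto simp: I inner_axis_axis intro!: sum.cong)
  also have "\<dots> = c * (real CARD('n) * (real CARD('n) + 2))"
    by (simp add: sum.distrib algebra_simps flip: sum_distrib_left)
  finally have "c / 3 = 1 / (real CARD('n) * (real CARD('n) + 2))"
    by (simp add: eq_divide_eq add_pos_pos less_imp_neq[symmetric])
  moreover have "sphere_mean (\<lambda>\<eta>. (v \<bullet> \<eta>)\<^sup>2 * (w \<bullet> \<eta>)\<^sup>2)
      = (c / 3) * ((norm v)\<^sup>2 * (norm w)\<^sup>2 + 2 * (v \<bullet> w)\<^sup>2)"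
    using I[of v w] by simp
  ultimately show ?thesis by simp
qed

section \<open>Mean and variance as traces of the Gram matrix\<close>

lemma power2_norm_transpose_mult:
  fixes T :: "real^'m^'n"
  shows "(norm (transpose T *v \<eta>))\<^sup>2 = (\<Sum>k\<in>UNIV. (column k T \<bullet> \<eta>)\<^sup>2)"
  unfolding power2_norm_eq_inner
  by (simp add: inner_vec_def matrix_vector_mult_def transpose_def column_def power2_eq_square)

lemma gram_matrix_nth: "(transpose T ** T) $ k $ l = column k T \<bullet> column l (T :: real^'m^'n)"
  by (simp add: matrix_matrix_mult_def inner_vec_def transpose_def column_def)

lemma E_sphere_eq_trace:
  fixes T :: "real^'m^'n"
  shows "E_sphere T = trace (transpose T ** T) / CARD('n)"
proof -
  have "E_sphere T = (\<Sum>k\<in>UNIV. sphere_mean (\<lambda>\<eta>. (column k T \<bullet> \<eta>)\<^sup>2))"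
    unfolding E_sphere_def power2_norm_transpose_mult
    by (subst sphere_mean_sum) (auto intro!: continuous_intros)
  then show ?thesis
    by (simp add: sphere_mean_inner_square trace_def gram_matrix_nth power2_norm_eq_inner
        sum_divide_distrib)
qed

text \<open>Squaring the sum over columns gives a double sum of mixed fourth moments. Their products
  of squared norms add up to the squared trace of \<open>S\<close>, their squared inner products to
  the trace of \<open>S ** S\<close>.\<close>

lemma sphere_mean_power4_norm:
  fixes T :: "real^'m^'n"
  defines "S \<equiv> transpose T ** T"
  shows "sphere_mean (\<lambda>\<eta>. ((norm (transpose T *v \<eta>))\<^sup>2)\<^sup>2)
     = ((trace S)\<^sup>2 + 2 * trace (S ** S)) / (real CARD('n) * (real CARD('n) + 2))"
proof -
  \<comment> \<open>\<open>S\<close> is symmetric, so the trace of its square is the sum of its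
    squared entries.\<close>
  have tr2: "trace (S ** S) = (\<Sum>k\<in>UNIV. \<Sum>l\<in>UNIV. (column k T \<bullet> column l T)\<^sup>2)"
    unfolding S_def trace_def
    by (simp add: matrix_matrix_mult_def[of "transpose T ** T" "transpose T ** T"] gram_matrix_nth
        power2_eq_square inner_commute)
  have tr1: "(trace S)\<^sup>2 = (\<Sum>k\<in>UNIV. \<Sum>l\<in>UNIV. (norm (column k T))\<^sup>2 * (norm (column l T))\<^sup>2)"
    unfolding power2_eq_square[of "trace S"]
    by (simp add: S_def trace_def gram_matrix_nth power2_norm_eq_inner sum_product)
  have "sphere_mean (\<lambda>\<eta>. ((norm (transpose T *v \<eta>))\<^sup>2)\<^sup>2)
      = sphere_mean (\<lambda>\<eta>. \<Sum>k\<in>UNIV. \<Sum>l\<in>UNIV. (column k T \<bullet> \<eta>)\<^sup>2 * (column l T \<bullet> \<eta>)\<^sup>2)"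
    unfolding power2_norm_transpose_mult by (simp add: power2_eq_square[of "sum _ _"] sum_product)
  also have "\<dots> = (\<Sum>k\<in>UNIV. \<Sum>l\<in>UNIV. sphere_mean (\<lambda>\<eta>. (column k T \<bullet> \<eta>)\<^sup>2 * (column l T \<bullet> \<eta>)\<^sup>2))"
    by (simp add: sphere_mean_sum continuous_intros)
  also have "\<dots> = ((trace S)\<^sup>2 + 2 * trace (S ** S)) / (real CARD('n) * (real CARD('n) + 2))"
    unfolding sphere_mean_inner_square_mult tr1 tr2
    by (simp add: sum_divide_distrib[symmetric] sum.distrib sum_distrib_left)
  finally show ?thesis .
qed

text \<open>The variance is the mean of the square minus the square of the mean; the rest brings the
  two fractions to a common denominator.\<close>

lemma V_sphere_eq_trace:
  fixes T :: "real^'m^'n"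
  defines "S \<equiv> transpose T ** T"
  shows "V_sphere T = (2 * real CARD('n) * trace (S ** S) - 2 * (trace S)\<^sup>2)
      / ((real CARD('n))\<^sup>2 * (real CARD('n) + 2))"
proof -
  let ?Q = "\<lambda>\<eta>. (norm (transpose T *v \<eta>))\<^sup>2" and ?E = "E_sphere T"
  have "V_sphere T = sphere_mean (\<lambda>\<eta>. (?Q \<eta>)\<^sup>2 + ((- 2 * ?E) * ?Q \<eta> + ?E\<^sup>2))"
    unfolding V_sphere_def by (rule sphere_mean_cong) (simp add: power2_diff)
  also have "\<dots> = sphere_mean (\<lambda>\<eta>. (?Q \<eta>)\<^sup>2) + ((- 2 * ?E) * sphere_mean ?Q + ?E\<^sup>2)"
    unfolding sphere_mean_cmult[symmetric] power2_norm_transpose_mult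
    by (subst sphere_mean_add, (intro continuous_intros)+)+ (simp add: sphere_mean_const)
  also have "\<dots> = sphere_mean (\<lambda>\<eta>. (?Q \<eta>)\<^sup>2) - ?E\<^sup>2"
    by (simp add: E_sphere_def power2_eq_square)
  also have "\<dots> = ((trace S)\<^sup>2 + 2 * trace (S ** S)) / (real CARD('n) * (real CARD('n) + 2))
      - (trace S)\<^sup>2 / (real CARD('n))\<^sup>2"
    unfolding E_sphere_eq_trace sphere_mean_power4_norm S_def by (simp add: power_divide)
  also have "\<dots> = (2 * real CARD('n) * trace (S ** S) - 2 * (trace S)\<^sup>2)
      / ((real CARD('n))\<^sup>2 * (real CARD('n) + 2))"
  proof -
    have "(a\<^sup>2 + 2 * b) / (N * (N + 2)) - a\<^sup>2 / N\<^sup>2 = (2 * N * b - 2 * a\<^sup>2) / (N\<^sup>2 * (N + 2))"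
      if "0 < N" for a b N :: real
    proof -
      have "N \<noteq> 0" "N + 2 \<noteq> 0" using that by auto
      then show ?thesis
        by (simp add: divide_simps) (simp add: power2_eq_square algebra_simps)
    qed
    then show ?thesis
      by (simp only: of_nat_0_less_iff zero_less_card_finite)
  qed
  finally show ?thesis .
qed

section \<open>Degree, leading coefficient and values of the characteristic polynomial\<close>

text \<open>The coefficient at \<open>card A\<close> is tracked instead of the leading one, since
  constant factors lower the degree. The two claims go through one induction: the degree bound
  removes the contribution of the constant term of the new factor.\<close>

lemma prod_degree_le_1:
  fixes f :: "'a \<Rightarrow> 'b::comm_ring_1 poly"
  assumes "finite A" "\<And>i. i \<in> A \<Longrightarrow> degree (f i) \<le> 1"
  shows "degree (prod f A) \<le> card A \<and> coeff (prod f A) (card A) = (\<Prod>i\<in>A. coeff (f i) 1)"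
  using assms
proof (induction rule: finite_induct)
  case (insert i A)
  then have IH: "degree (prod f A) \<le> card A" "coeff (prod f A) (card A) = (\<Prod>i\<in>A. coeff (f i) 1)"
    and i: "degree (f i) \<le> 1" by auto
  obtain a b where ab: "f i = [:a, b:]"
    using i by (cases "f i"; rename_tac b q; case_tac q) (auto split: if_splits)
  have "degree (f i * prod f A) \<le> 1 + card A"
    using degree_mult_le[of "f i" "prod f A"] i IH(1) by linarith
  moreover have "coeff (f i * prod f A) (Suc (card A)) = b * coeff (prod f A) (card A)"
    using IH(1) by (simp add: ab coeff_eq_0)
  ultimately show ?case
    using insert.hyps IH(2) ab by simp
qed simp

text \<open>Each term of the Leibniz expansion is a signed product of n entries of degree at most 1,
  so the coefficient of order n is the Leibniz expansion for the linear coefficients.\<close>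

lemma det_degree_le_1:
  fixes M :: "'b::comm_ring_1 poly^'n^'n"
  assumes "\<And>i j. degree (M $ i $ j) \<le> 1"
  shows degree_det_le: "degree (det M) \<le> CARD('n)"
    and coeff_det_card: "coeff (det M) CARD('n) = det (map_matrix (\<lambda>p. coeff p 1) M)"
proof -
  note P = prod_degree_le_1[of "UNIV :: 'n set" "\<lambda>i. M $ i $ p i" for p, OF _ assms]
  have sgn: "(of_int (sign p) :: 'b poly) = [:of_int (sign p):]" for p :: "'n \<Rightarrow> 'n"
    by (simp add: of_int_poly)
  show "degree (det M) \<le> CARD('n)"
    unfolding det_def sgn
  proof (rule degree_sum_le)
    fix p :: "'n \<Rightarrow> 'n"
    have "degree ([:of_int (sign p):] * (\<Prod>i\<in>UNIV. M $ i $ p i)) \<le> degree (\<Prod>i\<in>UNIV. M $ i $ p i)"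
      by (simp add: degree_smult_le)
    also have "\<dots> \<le> CARD('n)" using P by simp
    finally show "degree ([:of_int (sign p):] * (\<Prod>i\<in>UNIV. M $ i $ p i)) \<le> CARD('n)" .
  qed (simp add: finite_permutations)
  show "coeff (det M) CARD('n) = det (map_matrix (\<lambda>p. coeff p 1) M)"
    unfolding det_def sgn by (simp add: coeff_sum P)
qed

text \<open>The linear coefficients of the entries of xI - A form the identity matrix, whose
  determinant is 1.\<close>

lemma degree_charpoly: "degree (charpoly (A :: 'a::comm_ring_1^'n^'n)) = CARD('n)"
  and lead_coeff_charpoly: "coeff (charpoly (A :: 'a::comm_ring_1^'n^'n)) CARD('n) = 1"
proof -
  let ?M = "mat [:0, 1:] - map_matrix (\<lambda>a. [:a:]) A"
  have deg: "degree (?M $ i $ j) \<le> 1" for i j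
    by (simp add: mat_def)
  have "map_matrix (\<lambda>p. coeff p 1) ?M = mat 1"
    by (simp add: vec_eq_iff mat_def)
  then show lc: "coeff (charpoly A) CARD('n) = 1"
    unfolding charpoly_def coeff_det_card[OF deg] by simp
  show "degree (charpoly A) = CARD('n)"
    using degree_det_le[OF deg] lc unfolding charpoly_def
    by (intro antisym le_degree) auto
qed

lemma poly_det:
  fixes M :: "'a::comm_ring_1 poly^'n^'n"
  shows "poly (det M) x = det (map_matrix (\<lambda>p. poly p x) M)"
  unfolding det_def by (simp add: poly_sum poly_prod)

lemma poly_charpoly: "poly (charpoly A) x = det (mat x - A)"
proof -
  have "map_matrix (\<lambda>p. poly p x) (mat [:0, 1:] - map_matrix (\<lambda>a. [:a:]) A) = mat x - A"
    by (simp add: vec_eq_iff mat_def)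
  then show ?thesis by (simp add: charpoly_def poly_det)
qed

section \<open>Power sums of the roots as traces\<close>

text \<open>As many roots as the degree, with multiplicity, force the polynomial to split. The
  induction strips off the full power of one root at a time; a polynomial without roots then has
  degree 0.\<close>

lemma poly_eq_prod_proots:
  fixes p :: "'a::idom poly"
  assumes "size (proots p) = degree p"
  shows "p = smult (lead_coeff p) (\<Prod>x\<in>#proots p. [:-x, 1:])"
  using assms
proof (induction p rule: poly_root_order_induct)
  case (no_roots p)
  then have "proots p = {#}"
    by (auto simp: multiset_eq_iff order_root intro: order_0I)
  then have "degree p = 0" using no_roots by simp
  then show ?case using \<open>proots p = {#}\<close> by (auto elim: degree_eq_zeroE)
next
  case (root p x n)
  then have "p \<noteq> 0" by auto
  then have pr: "proots ([:-x, 1:] ^ n * p) = replicate_mset n x + proots p"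
    by (simp add: proots_mult proots_power)
  \<comment> \<open>Removing the factor lowers the degree and the number of roots by the same
    \<open>n\<close>.\<close>
  have "size (proots p) = degree p"
    using root.prems \<open>p \<noteq> 0\<close> unfolding pr by (simp add: degree_mult_eq degree_power_eq)
  then have "p = smult (lead_coeff p) (\<Prod>x\<in>#proots p. [:-x, 1:])"
    by (rule root.IH)
  moreover have "lead_coeff ([:-x, 1:] ^ n * p) = lead_coeff p"
    by (simp only: lead_coeff_mult lead_coeff_power) simp
  ultimately show ?case
    unfolding pr by (simp flip: mult_smult_right)
qed auto

text \<open>All factors are 1 at 0, so the product rule leaves the sum of the derivatives
  \<open>- x\<close>. The arbitrary set \<open>S\<close> allows one-sided derivatives.\<close>

lemma prod_mset_has_derivative_at_0:
  "((\<lambda>u. \<Prod>x\<in>#X. 1 - u * x) has_real_derivative - (\<Sum>x\<in>#X. x)) (at 0 within S)"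
proof (induction X)
  case (add x X)
  have "((\<lambda>u. (1 - u * x) * (\<Prod>x\<in>#X. 1 - u * x)) has_real_derivative - (\<Sum>y\<in>#add_mset x X. y)) (at 0 within S)"
    by (rule derivative_eq_intros add.IH refl)+ simp
  then show ?case by simp
qed simp

text \<open>Jacobi's formula at the identity: in the differentiated Leibniz expansion only the
  identity permutation survives.\<close>

lemma det_has_derivative_at_0:
  fixes A :: "real^'n^'n"
  shows "((\<lambda>u. det (mat 1 - u *\<^sub>R A)) has_real_derivative - trace A) (at 0)"
proof -
  let ?f = "\<lambda>p i u. (mat 1 - u *\<^sub>R A) $ i $ p i"
  let ?P = "{p. p permutes (UNIV :: 'n set)}"
  have d: "(?f p i has_real_derivative - (A $ i $ p i)) (at 0)" for p i
    by (auto intro!: derivative_eq_intros)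
  define D where "D = (\<lambda>p. \<Sum>i\<in>UNIV. - (A $ i $ p i) * (\<Prod>j\<in>UNIV-{i}. ?f p j 0))"
  have "((\<lambda>u. \<Sum>p\<in>?P. of_int (sign p) * (\<Prod>i\<in>UNIV. ?f p i u))
      has_real_derivative (\<Sum>p\<in>?P. of_int (sign p) * D p)) (at 0)"
    unfolding D_def by (intro DERIV_sum DERIV_cmult has_field_derivative_prod d)
  also have "(\<Sum>p\<in>?P. of_int (sign p) * D p) = (\<Sum>p\<in>{id}. of_int (sign p) * D p)"
  proof (rule sum.mono_neutral_right)
    show "\<forall>p\<in>?P - {id}. of_int (sign p) * D p = 0"
    proof
      fix p assume p: "p \<in> ?P - {id}"
      have zero: "(\<Prod>j\<in>UNIV-{i}. ?f p j 0) = 0" for i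
      proof -
        \<comment> \<open>A permutation other than the identity moves at least two points, so an
          off-diagonal entry of the identity matrix remains after factor \<open>i\<close> is
          removed.\<close>
        have "\<exists>j. j \<noteq> i \<and> p j \<noteq> j"
        proof (rule ccontr)
          assume no: "\<not> (\<exists>j. j \<noteq> i \<and> p j \<noteq> j)"
          have "inj p" using p by (auto intro: permutes_inj)
          then have "p i = i" using no by (metis injD)
          then have "p = id" using no by (auto simp: fun_eq_iff)
          then show False using p by simp
        qed
        then obtain j where "j \<in> UNIV - {i}" "p j \<noteq> j" by auto
        then show ?thesis by (intro prod_zero) (auto simp: mat_def intro!: bexI[of _ j])
      qed
      show "of_int (sign p) * D p = 0" unfolding D_def zero by simp
    qed
  qed (auto simp: finite_permutations permutes_id)
  also have "\<dots> = - trace A"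
    by (simp add: D_def trace_def mat_def sum_negf)
  finally show ?thesis by (simp add: det_def)
qed

text \<open>Compares the derivatives at 0 of the two sides. Right-hand limits suffice, which later
  permits the substitution u = t^2.\<close>

lemma trace_eq_sum_mset:
  fixes A :: "real^'n^'n"
  assumes "\<And>u. u > 0 \<Longrightarrow> det (mat 1 - u *\<^sub>R A) = (\<Prod>x\<in>#X. 1 - u * x)"
  shows "trace A = (\<Sum>x\<in>#X. x)"
proof -
  let ?g = "\<lambda>u. \<Prod>x\<in>#X. 1 - u * x"
  have "((\<lambda>u. (det (mat 1 - u *\<^sub>R A) - 1) / u) \<longlongrightarrow> - trace A) (at_right 0)"
    using has_field_derivative_at_within[OF det_has_derivative_at_0[of A], of "{0<..}"]
    by (simp add: has_field_derivative_iff)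
  moreover have "\<forall>\<^sub>F u in at_right 0. (det (mat 1 - u *\<^sub>R A) - 1) / u = (?g u - 1) / u"
    using eventually_at_right_less[of 0] by eventually_elim (simp add: assms)
  ultimately have "((\<lambda>u. (?g u - 1) / u) \<longlongrightarrow> - trace A) (at_right 0)"
    by (rule Lim_transform_eventually)
  moreover have "((\<lambda>u. (?g u - 1) / u) \<longlongrightarrow> - (\<Sum>x\<in>#X. x)) (at_right 0)"
    using prod_mset_has_derivative_at_0[of X "{0<..}"]
    by (simp add: has_field_derivative_iff)
  ultimately show ?thesis
    using tendsto_unique[of "at_right (0::real)"] by fastforce
qed

lemma det_scaleR: "det (c *\<^sub>R A) = c ^ CARD('n) * det (A :: real^'n^'n)"
  by (simp add: det_def prod.distrib sum_distrib_left mult_ac)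

text \<open>The second power sum comes from $\det (1 - t A) \det (1 + t A) = \det (1 - t^2 A^2)$.\<close>

lemma trace_proots_charpoly:
  fixes A :: "real^'n^'n"
  assumes "size (proots (charpoly A)) = CARD('n)"
  shows trace_eq_sum_proots: "trace A = (\<Sum>x\<in>#proots (charpoly A). x)"
    and trace_square_eq_sum_proots: "trace (A ** A) = (\<Sum>x\<in>#proots (charpoly A). x\<^sup>2)"
proof -
  let ?X = "proots (charpoly A)"
  have cp: "charpoly A = (\<Prod>x\<in>#?X. [:-x, 1:])"
    using poly_eq_prod_proots[of "charpoly A"] assms
    by (simp add: degree_charpoly lead_coeff_charpoly)
  have prod_scale: "u ^ size X * (\<Prod>x\<in>#X. 1 / u - x) = (\<Prod>x\<in>#X. 1 - u * x)"
    if "u \<noteq> 0" for u :: real and X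
    using that by (induction X) (auto simp: field_simps)
  \<comment> \<open>This is the reversed characteristic polynomial: det(1 - uA) = u^n det(1/u - A)
    for nonzero u.\<close>
  have det: "det (mat 1 - u *\<^sub>R A) = (\<Prod>x\<in>#?X. 1 - u * x)" if "u \<noteq> 0" for u
  proof -
    have "mat 1 - u *\<^sub>R A = u *\<^sub>R (mat (1 / u) - A)"
      using that by (simp add: vec_eq_iff mat_def right_diff_distrib)
    then have "det (mat 1 - u *\<^sub>R A) = u ^ CARD('n) * poly (charpoly A) (1 / u)"
      by (simp add: det_scaleR poly_charpoly)
    also have "poly (charpoly A) (1 / u) = (\<Prod>x\<in>#?X. 1 / u - x)"
      by (subst cp) (simp add: poly_prod_mset multiset.map_comp comp_def)
    finally show ?thesis using prod_scale[OF that, of ?X] assms by simp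
  qed
  show "trace A = (\<Sum>x\<in>#?X. x)"
    by (rule trace_eq_sum_mset) (simp add: det)
  \<comment> \<open>\<open>trace_eq_sum_mset\<close> accepts any multiset that factors the
    determinant, so the squared roots of \<open>A\<close> can be used directly for
    \<open>A ** A\<close>.\<close>
  have "trace (A ** A) = (\<Sum>x\<in>#image_mset (\<lambda>x. x\<^sup>2) ?X. x)"
  proof (rule trace_eq_sum_mset)
    fix u :: real assume "u > 0"
    define t where "t = sqrt u"
    have t: "t \<noteq> 0" "u = t * t" using \<open>u > 0\<close> by (auto simp: t_def)
    have "(B - C) ** A = B ** A - C ** A" for B C :: "real^'n^'n"
      by (simp add: vec_eq_iff matrix_matrix_mult_def left_diff_distrib sum_subtractf)
    then have "mat 1 - u *\<^sub>R (A ** A) = (mat 1 - t *\<^sub>R A) ** (mat 1 - (- t) *\<^sub>R A)"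
      by (simp add: t matrix_add_ldistrib matrix_scalar_ac scaleR_right_diff_distrib
          flip: scalar_matrix_assoc)
    then have "det (mat 1 - u *\<^sub>R (A ** A)) = (\<Prod>x\<in>#?X. 1 - t * x) * (\<Prod>x\<in>#?X. 1 - (- t) * x)"
      using t by (simp only: det_mul det) (simp add: det)
    also have "\<dots> = (\<Prod>x\<in>#image_mset (\<lambda>x. x\<^sup>2) ?X. 1 - u * x)"
    proof -
      have "(\<Prod>x\<in>#X. 1 - t * x) * (\<Prod>x\<in>#X. 1 - (- t) * x)
          = (\<Prod>x\<in>#image_mset (\<lambda>x. x\<^sup>2) X. 1 - u * x)" for X
        unfolding t(2) by (induction X) (simp_all add: algebra_simps power2_eq_square)
      then show ?thesis .
    qed
    finally show "det (mat 1 - u *\<^sub>R (A ** A)) = (\<Prod>x\<in>#image_mset (\<lambda>x. x\<^sup>2) ?X. 1 - u * x)" .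
  qed
  then show "trace (A ** A) = (\<Sum>x\<in>#?X. x\<^sup>2)"
    by (simp add: multiset.map_comp comp_def)
qed

section \<open>Singular values\<close>

text \<open>A root x is an eigenvalue; for an eigenvector v, x |v|^2 = |Tv|^2. Nonnegativity lets
  squaring undo \<open>sqrt\<close>, which on a negative x would give -x.\<close>

lemma proots_charpoly_gram_nonneg:
  fixes T :: "real^'m^'n"
  assumes "x \<in># proots (charpoly (transpose T ** T))"
  shows "0 \<le> x"
proof -
  let ?S = "transpose T ** T"
  have "charpoly ?S \<noteq> 0"
    using lead_coeff_charpoly[of ?S] by auto
  then have "det (mat x - ?S) = 0"
    using assms by (simp flip: poly_charpoly)
  then obtain v where "(mat x - ?S) *v v = 0" "v \<noteq> 0"
    using matrix_left_invertible_ker[of "mat x - ?S"]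
    by (metis invertible_det_nz invertible_left_inverse)
  moreover have "mat x *v v = x *\<^sub>R v"
    by (simp add: vec_eq_iff matrix_vector_mult_def mat_def if_distrib if_distribR sum.delta cong: if_cong)
  ultimately have "?S *v v = x *\<^sub>R v"
    by (simp add: matrix_vector_mult_diff_rdistrib)
  then have "x * (v \<bullet> v) = v \<bullet> (?S *v v)" by simp
  also have "\<dots> = (T *v v) \<bullet> (T *v v)"
    using dot_lmul_matrix[of "T *v v" T v]
    by (simp add: inner_commute matrix_vector_mul_assoc[symmetric])
  finally show ?thesis
    using \<open>v \<noteq> 0\<close> by (metis inner_ge_zero inner_gt_zero_iff zero_le_mult_iff not_less)
qed

text \<open>There is one singular value per real root, so the size assumption says that the
  characteristic polynomial splits over the reals.\<close>

lemma
  fixes T :: "real^'m^'n"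
  assumes "size (singular_values T) = CARD('m)"
  shows trace_gram_eq_sum_singular_values:
      "trace (transpose T ** T) = (\<Sum>s\<in>#singular_values T. s\<^sup>2)"
    and trace_gram_square_eq_sum_singular_values:
      "trace ((transpose T ** T) ** (transpose T ** T)) = (\<Sum>s\<in>#singular_values T. s ^ 4)"
proof -
  let ?S = "transpose T ** T"
  have sz: "size (proots (charpoly ?S)) = CARD('m)"
    using assms by (simp add: singular_values_def)
  let ?X = "proots (charpoly ?S)"
  have sqrt4: "sqrt x ^ 4 = x\<^sup>2" if "0 \<le> x" for x
    using that power_mult[of "sqrt x" 2 2] by simp
  have "image_mset (\<lambda>x. (sqrt x)\<^sup>2) ?X = image_mset (\<lambda>x. x) ?X"
    by (rule image_mset_cong) (simp add: proots_charpoly_gram_nonneg)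
  moreover have "image_mset (\<lambda>x. sqrt x ^ 4) ?X = image_mset (\<lambda>x. x\<^sup>2) ?X"
    by (rule image_mset_cong) (simp add: proots_charpoly_gram_nonneg sqrt4)
  ultimately show "trace ?S = (\<Sum>s\<in>#singular_values T. s\<^sup>2)"
    and "trace (?S ** ?S) = (\<Sum>s\<in>#singular_values T. s ^ 4)"
    by (simp_all only: trace_eq_sum_proots[OF sz] trace_square_eq_sum_proots[OF sz]
        singular_values_def image_mset.compositionality comp_def)
qed

theorem lemma3p2:
  fixes T :: "real^'m^'n" and \<sigma> :: "nat \<Rightarrow> real" and n m :: nat and A1 A2 :: real
  assumes n: "n = CARD('n)" and m: "m = CARD('m)"
    and "1 \<le> m" and "m < n"
    and "rank T = m"
    and "singular_values T = image_mset \<sigma> (mset_set {1..m})"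
    and A1: "A1 = (\<Sum>i=1..m. (\<sigma> i)^2)" and A2: "A2 = (\<Sum>i=1..m. (\<sigma> i)^4)"
  shows "(\<forall>T' :: real^'m^'n. rank T' = m \<and> singular_values T' = singular_values T
            \<longrightarrow> E_sphere T' = E_sphere T \<and> V_sphere T' = V_sphere T)
       \<and> E_sphere T = A1 / real n
       \<and> V_sphere T = (2 * real n * A2 - 2 * A1^2) / ((real n)^2 * (real n + 2))"
proof -
  \<comment> \<open>Proved for every \<open>T'\<close> with the singular values of \<open>T\<close>:
    the right-hand sides do not mention \<open>T'\<close>, so this also gives the claim that only
    the singular values matter.\<close>
  have formulas: "E_sphere T' = A1 / real n
      \<and> V_sphere T' = (2 * real n * A2 - 2 * A1^2) / ((real n)^2 * (real n + 2))"
    if eq: "singular_values T' = singular_values T" for T' :: "real^'m^'n"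
  proof -
    have sv: "singular_values T' = image_mset \<sigma> (mset_set {1..m})"
      using eq assms by simp
    \<comment> \<open>The enumeration by \<sigma> supplies the m real roots, that is, the
      splitting.\<close>
    then have sz: "size (singular_values T') = CARD('m)"
      by (simp add: m)
    have "trace (transpose T' ** T') = A1"
      unfolding trace_gram_eq_sum_singular_values[OF sz] sv A1
      by (simp add: multiset.map_comp comp_def sum_unfold_sum_mset)
    moreover have "trace ((transpose T' ** T') ** (transpose T' ** T')) = A2"
      unfolding trace_gram_square_eq_sum_singular_values[OF sz] sv A2
      by (simp add: multiset.map_comp comp_def sum_unfold_sum_mset)
    ultimately show ?thesis
      by (simp only: E_sphere_eq_trace V_sphere_eq_trace n)
  qed
  then show ?thesis by simp
qed

end
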